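(* Let $n\ge 2$ and consider a mechanical Lagrangian with one degree of underactuation, in local coordinates $(x,\theta^2,\dots,\theta^n)$, $$L(x,\dot x,\dot\theta)=\tfrac12 g_{11}(x)\dot x^2+g_{1a}(x)\dot x\,\dot\theta^a+\tfrac12 g_{ab}\dot\theta^a\dot\theta^b-V(x),$$ where the matrix $(g_{ab})_{a,b=2}^n$ is constant, and suppose $\sigma_{ab}=\sigma g_{ab}$ for a constant $\sigma$. Let $\tau^a=\tau^a(x)$, $a=2,\dots,n$, be smooth functions satisfying the ODE system $$2\tau^a g_{1e}g^{ec}g_{1c}'+2\tau^a g_{1e}(\tau^e)'-\tau^a g_{11}'+2g_{11}(\tau^a)'-2g_{1c}g^{dc}g_{d1}(\tau^a)'-2g_{1c}\tau^c(\tau^a)'=0,\qquad a=2,\dots,n,$$ and such that the regularity assumptions stated in the context hold. Consider the controlled Euler-Lagrange equations $$\frac{d}{dt}\frac{\partial L}{\partial\dot x}-\frac{\partial L}{\partial x}=0,\qquad \frac{d}{dt}\frac{\partial L}{\partial\dot\theta^a}=u_a,\qquad u_a=-\frac{d}{dt}\left(g_{ab}\tau^b\dot x\right)=-g_{ab}(\tau^b)'\dot x^2-g_{ab}\tau^b\ddot x,\quad a=2,\dots,n.$$ Then the control $u_a$ is independent of velocities: when $\ddot x$ is replaced by its expression as a function of $(x,\theta,\dot x,\dot\theta)$ determined by these equations, each $u_a$ becomes a function of the configuration variables only.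
   Context: Conventions: repeated indices are summed; Latin indices $a,b,c,d,e$ run over $2,\dots,n$; $(g^{ab})$ is the inverse of $(g_{ab})$; $g_{a1}=g_{1a}$; a prime denotes $d/dx$. All data are smooth. The full matrix $\begin{pmatrix} g_{11}&g_{1b}\\ g_{1a}&g_{ab}\end{pmatrix}$ is the (symmetric, positive definite) matrix of a Riemannian metric in local coordinates; its coefficients and $V$ depend only on $x$. "One degree of underactuation" means there is exactly one unactuated variable, $x$. All assertions are local, in a coordinate chart. Regularity assumptions: (i) the matrix $$\tilde C=\begin{pmatrix} g_{11}& g_{1b}\\ g_{1a}+g_{ad}\tau^d& g_{ab}\end{pmatrix}$$ is invertible, equivalently $A_{11}=g_{11}-g_{1b}g^{ab}(g_{a1}+g_{ad}\tau^d)$ is nowhere zero, so that the controlled Euler-Lagrange equations can be solved uniquely for the accelerations; (ii) the associated controlled Lagrangian is regular, i.e. the Hessian with respect to $(\dot x,\dot\theta^2,\dots,\dot\theta^n)$ of $$K_{\tau,\sigma}=\tfrac12\left(g_{11}+2g_{1a}\tau^a+(1+\sigma)g_{ab}\tau^a\tau^b\right)\dot x^2+(g_{1a}+g_{ab}\tau^b)\dot x\,\dot\theta^a+\tfrac12 g_{ab}\dot\theta^a\dot\theta^b$$ is invertible. *)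

theory Defs
  imports "HOL-Analysis.Analysis"
begin

text \<open>
  Coordinates are indexed by \<open>'m option\<close>: \<open>None\<close> is the index 1, that of the unactuated
  variable \<open>x\<close>, and \<open>Some a\<close> with \<open>a :: 'm\<close> is one of the indices \<open>2, \<dots>, n\<close> of the actuated
  variables \<open>\<theta>\<^sup>a\<close>. Hence \<open>n = CARD('m) + 1 \<ge> 2\<close>. The metric coefficients \<open>g\<^sub>1\<^sub>1\<close>, \<open>g\<^sub>1\<^sub>a\<close>, the potential
  and \<open>\<tau>\<^sup>a\<close> are functions of \<open>x\<close> alone; \<open>g\<^sub>a\<^sub>b\<close> is a constant matrix.
\<close>

text \<open>Smoothness of a function of one real variable; intended for open \<open>S\<close> only.\<close>

definition smooth_on :: "real set \<Rightarrow> (real \<Rightarrow> real) \<Rightarrow> bool" where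
  "smooth_on S f \<longleftrightarrow> (\<forall>k. \<forall>x\<in>S. ((deriv ^^ k) f) differentiable (at x))"

definition partial :: "'i \<Rightarrow> (real ^ 'i \<Rightarrow> real) \<Rightarrow> real ^ 'i \<Rightarrow> real" where
  "partial i f p = deriv (\<lambda>s. f (\<chi> j. if j = i then s else p $ j)) (p $ i)"

definition hessian :: "(real ^ 'i \<Rightarrow> real) \<Rightarrow> real ^ 'i \<Rightarrow> real ^ 'i ^ 'i" where
  "hessian f p = (\<chi> i j. partial i (partial j f) p)"

definition velocity :: "(real \<Rightarrow> real ^ 'i) \<Rightarrow> real \<Rightarrow> real ^ 'i" where
  "velocity q t = (\<chi> i. deriv (\<lambda>s. q s $ i) t)"

definition acceleration :: "(real \<Rightarrow> real ^ 'i) \<Rightarrow> real \<Rightarrow> real ^ 'i" where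
  "acceleration q = velocity (velocity q)"

definition smooth_curve :: "real set \<Rightarrow> (real ^ 'i) set \<Rightarrow> (real \<Rightarrow> real ^ 'i) \<Rightarrow> bool" where
  "smooth_curve T Q q \<longleftrightarrow> open T \<and> (\<forall>i. smooth_on T (\<lambda>t. q t $ i)) \<and> q ` T \<subseteq> Q"

definition positive_definite_matrix :: "real ^ 'i ^ 'i \<Rightarrow> bool" where
  "positive_definite_matrix M \<longleftrightarrow> (\<forall>v. v \<noteq> 0 \<longrightarrow> 0 < v \<bullet> (M *v v))"

text \<open>The matrix with top left entry \<open>a\<close>, remaining first row \<open>r\<close>, remaining first column \<open>c\<close>
  and lower right block \<open>G\<close>.\<close>

definition block_matrix ::
    "real \<Rightarrow> real ^ 'm \<Rightarrow> real ^ 'm \<Rightarrow> real ^ 'm ^ 'm \<Rightarrow> real ^ 'm option ^ 'm option" where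
  "block_matrix a r c G =
     (\<chi> i j. case (i, j) of
        (None, None) \<Rightarrow> a
      | (None, Some q) \<Rightarrow> r $ q
      | (Some p, None) \<Rightarrow> c $ p
      | (Some p, Some q) \<Rightarrow> G $ p $ q)"

definition metric_matrix ::
    "(real \<Rightarrow> real) \<Rightarrow> (real \<Rightarrow> real ^ 'm) \<Rightarrow> real ^ 'm ^ 'm \<Rightarrow> real \<Rightarrow> real ^ 'm option ^ 'm option" where
  "metric_matrix g11 g1 g x = block_matrix (g11 x) (g1 x) (g1 x) g"

text \<open>The coefficient matrix of the accelerations in the controlled Euler-Lagrange equations.\<close>

definition C_tilde ::
    "(real \<Rightarrow> real) \<Rightarrow> (real \<Rightarrow> real ^ 'm) \<Rightarrow> real ^ 'm ^ 'm \<Rightarrow> (real \<Rightarrow> real ^ 'm)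
     \<Rightarrow> real \<Rightarrow> real ^ 'm option ^ 'm option" where
  "C_tilde g11 g1 g \<tau> x =
     block_matrix (g11 x) (g1 x) (\<chi> a. g1 x $ a + (\<Sum>d\<in>UNIV. g $ a $ d * \<tau> x $ d)) g"

definition Lagrangian ::
    "(real \<Rightarrow> real) \<Rightarrow> (real \<Rightarrow> real ^ 'm::finite) \<Rightarrow> real ^ 'm ^ 'm \<Rightarrow> (real \<Rightarrow> real)
     \<Rightarrow> real ^ 'm option \<Rightarrow> real ^ 'm option \<Rightarrow> real" where
  "Lagrangian g11 g1 g V q v =
     1/2 * g11 (q $ None) * (v $ None)\<^sup>2
     + (\<Sum>a\<in>UNIV. g1 (q $ None) $ a * v $ None * v $ Some a)
     + 1/2 * (\<Sum>a\<in>UNIV. \<Sum>b\<in>UNIV. g $ a $ b * v $ Some a * v $ Some b)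
     - V (q $ None)"

text \<open>The kinetic energy \<open>K\<^sub>\<tau>\<^sub>,\<^sub>\<sigma>\<close> of the controlled Lagrangian for the choice
  \<open>\<sigma>\<^sub>a\<^sub>b = \<sigma> g\<^sub>a\<^sub>b\<close>, which is already substituted, as a function of the velocity \<open>v\<close>.\<close>

definition controlled_kinetic ::
    "(real \<Rightarrow> real) \<Rightarrow> (real \<Rightarrow> real ^ 'm::finite) \<Rightarrow> real ^ 'm ^ 'm \<Rightarrow> (real \<Rightarrow> real ^ 'm) \<Rightarrow> real
     \<Rightarrow> real \<Rightarrow> real ^ 'm option \<Rightarrow> real" where
  "controlled_kinetic g11 g1 g \<tau> \<sigma> x v =
     1/2 * (g11 x + 2 * (\<Sum>a\<in>UNIV. g1 x $ a * \<tau> x $ a)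
            + (1 + \<sigma>) * (\<Sum>a\<in>UNIV. \<Sum>b\<in>UNIV. g $ a $ b * \<tau> x $ a * \<tau> x $ b)) * (v $ None)\<^sup>2
     + (\<Sum>a\<in>UNIV. (g1 x $ a + (\<Sum>b\<in>UNIV. g $ a $ b * \<tau> x $ b)) * v $ None * v $ Some a)
     + 1/2 * (\<Sum>a\<in>UNIV. \<Sum>b\<in>UNIV. g $ a $ b * v $ Some a * v $ Some b)"

definition control_along ::
    "real ^ 'm::finite ^ 'm \<Rightarrow> (real \<Rightarrow> real ^ 'm) \<Rightarrow> (real \<Rightarrow> real ^ 'm option) \<Rightarrow> 'm \<Rightarrow> real \<Rightarrow> real" where
  "control_along g \<tau> q a t =
     - deriv (\<lambda>s. (\<Sum>b\<in>UNIV. g $ a $ b * \<tau> (q s $ None) $ b) * velocity q s $ None) t"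

text \<open>The same control with \<open>d/dt\<close> carried out, as a function of \<open>x\<close>, the velocity \<open>xd\<close> and the
  acceleration \<open>xdd\<close> of \<open>x\<close>.\<close>

definition control_law ::
    "real ^ 'm::finite ^ 'm \<Rightarrow> (real \<Rightarrow> real ^ 'm) \<Rightarrow> 'm \<Rightarrow> real \<Rightarrow> real \<Rightarrow> real \<Rightarrow> real" where
  "control_law g \<tau> a x xd xdd =
     - (\<Sum>b\<in>UNIV. g $ a $ b * deriv (\<lambda>y. \<tau> y $ b) x) * xd\<^sup>2
     - (\<Sum>b\<in>UNIV. g $ a $ b * \<tau> x $ b) * xdd"

definition controlled_Euler_Lagrange ::
    "(real ^ 'm::finite option \<Rightarrow> real ^ 'm option \<Rightarrow> real) \<Rightarrow> ('m \<Rightarrow> real \<Rightarrow> real)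
     \<Rightarrow> (real \<Rightarrow> real ^ 'm option) \<Rightarrow> real \<Rightarrow> bool" where
  "controlled_Euler_Lagrange L u q t \<longleftrightarrow>
     deriv (\<lambda>s. partial None (L (q s)) (velocity q s)) t
       - partial None (\<lambda>p. L p (velocity q t)) (q t) = 0
     \<and> (\<forall>a. deriv (\<lambda>s. partial (Some a) (L (q s)) (velocity q s)) t = u a t)"

end

theory Submission
  imports Defs
begin

text \<open>
  Carrying out the derivatives turns the controlled Euler-Lagrange equations into the linear system
  \<open>C_tilde *v acc = forcing\<close> for the accelerations (\<open>controlled_Euler_Lagrange_iff\<close>). This
  system is simple for two reasons: the mixed terms \<open>g\<^sub>1\<^sub>a' \<cdot> v\<^sup>1 \<cdot> v\<^sup>a\<close> drop out of
  the \<open>x\<close>-equation, and \<open>\<theta>\<^sup>a\<close> is cyclic. So the forcing involves the velocities only through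
  \<open>(v\<^sup>1)\<^sup>2\<close>.

  Eliminating the accelerations of the \<open>\<theta>\<^sup>a\<close> by means of \<open>g\<^sup>-\<^sup>1\<close> leaves one scalar equation
  \<open>A acc\<^sup>1 = B (v\<^sup>1)\<^sup>2 - V'\<close> (\<open>unactuated_acceleration\<close>), with \<open>A\<close> the Schur complement of \<open>g\<close> in
  \<open>C_tilde\<close> and \<open>B = g\<^sub>1\<^sub>e g\<^sup>e\<^sup>c g\<^sub>1\<^sub>c' + g\<^sub>1\<^sub>e (\<tau>\<^sup>e)' - g\<^sub>1\<^sub>1'/2\<close>. In terms of \<open>A\<close> and \<open>B\<close> the ODE system
  for \<open>\<tau>\<close> says precisely \<open>\<tau>\<^sup>a B + A (\<tau>\<^sup>a)' = 0\<close>. Therefore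
  \<open>A ((\<tau>\<^sup>b)' (v\<^sup>1)\<^sup>2 + \<tau>\<^sup>b acc\<^sup>1) = (A (\<tau>\<^sup>b)' + B \<tau>\<^sup>b) (v\<^sup>1)\<^sup>2 - \<tau>\<^sup>b V' = - \<tau>\<^sup>b V'\<close>, and since \<open>A\<close> does
  not vanish (\<open>Schur_complement_nonzero\<close>) the control is
  \<open>u\<^sub>a = g\<^sub>a\<^sub>b \<tau>\<^sup>b V' / A\<close>, a function of \<open>x\<close> alone.
\<close>

section \<open>Block matrices\<close>

lemma sum_UNIV_option:
  fixes f :: "'m::finite option \<Rightarrow> 'b::comm_monoid_add"
  shows "(\<Sum>i\<in>UNIV. f i) = f None + (\<Sum>a\<in>UNIV. f (Some a))"
  by (simp add: UNIV_option_conv sum.reindex)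

lemma block_matrix_mult:
  fixes w :: "real ^ 'm::finite option"
  shows "(block_matrix a r c G *v w) $ None = a * w $ None + (\<Sum>b\<in>UNIV. r $ b * w $ Some b)"
    and "(block_matrix a r c G *v w) $ Some p = c $ p * w $ None + (\<Sum>b\<in>UNIV. G $ p $ b * w $ Some b)"
  by (simp_all add: block_matrix_def matrix_vector_mult_def sum_UNIV_option)

lemma
  fixes M :: "real ^ 'n::finite ^ 'n"
  assumes "invertible M"
  shows matrix_inv_left: "matrix_inv M ** M = mat 1"
    and matrix_inv_right: "M ** matrix_inv M = mat 1"
  using someI_ex[OF assms[unfolded invertible_def]] by (simp_all add: matrix_inv_def)

text \<open>A vector in the kernel of \<open>g\<close>, extended by zero, is isotropic for the whole metric.\<close>

lemma invertible_actuated_block: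
  fixes g :: "real ^ 'm::finite ^ 'm"
  assumes "positive_definite_matrix (metric_matrix g11 g1 g x)"
  shows "invertible g"
proof -
  have "w = 0" if w: "g *v w = 0" for w
  proof (rule ccontr)
    assume "w \<noteq> 0"
    define v :: "real ^ 'm option" where "v = (\<chi> i. case i of None \<Rightarrow> 0 | Some a \<Rightarrow> w $ a)"
    have v: "v $ None = 0" "v $ Some a = w $ a" for a
      by (simp_all add: v_def)
    from \<open>w \<noteq> 0\<close> have "v \<noteq> 0"
      using v(2) by (metis vec_eq_iff zero_index)
    moreover have "(\<Sum>b\<in>UNIV. g $ a $ b * w $ b) = 0" for a
      using arg_cong[OF w, of "\<lambda>u. u $ a"] by (simp add: matrix_vector_mult_def)
    then have "v \<bullet> (metric_matrix g11 g1 g x *v v) = 0"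
      by (simp add: inner_vec_def sum_UNIV_option metric_matrix_def block_matrix_mult v)
    ultimately show False
      using assms unfolding positive_definite_matrix_def by force
  qed
  then show ?thesis
    by (simp add: invertible_left_inverse matrix_left_invertible_ker)
qed

text \<open>Otherwise \<open>(1, - G\<^sup>-\<^sup>1 c)\<close> would be a nonzero kernel vector of the block matrix.\<close>

lemma Schur_complement_nonzero:
  fixes r c :: "real ^ 'm::finite"
  assumes "invertible (block_matrix a r c G)" and "invertible G"
  shows "a - r \<bullet> (matrix_inv G *v c) \<noteq> 0"
proof
  assume 0: "a - r \<bullet> (matrix_inv G *v c) = 0"
  define w where "w = matrix_inv G *v c"
  define v :: "real ^ 'm option" where "v = (\<chi> i. case i of None \<Rightarrow> 1 | Some b \<Rightarrow> - w $ b)"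
  have v: "v $ None = 1" "v $ Some b = - w $ b" for b
    by (simp_all add: v_def)
  have "G *v w = c"
    by (simp add: w_def matrix_vector_mul_assoc matrix_inv_right assms(2))
  then have "(\<Sum>b\<in>UNIV. G $ p $ b * w $ b) = c $ p" for p
    by (auto simp: matrix_vector_mult_def)
  then have "block_matrix a r c G *v v = 0"
    using 0 by (simp add: vec_eq_iff split_option_all block_matrix_mult v sum_negf
        inner_vec_def w_def[symmetric])
  then have "v = 0"
    using assms(1) by (metis invertible_left_inverse matrix_left_invertible_ker)
  then show False
    using v(1) by simp
qed

section \<open>Derivatives of the Lagrangian along a curve\<close>

lemma smooth_on_has_derivative:
  assumes "smooth_on S f" and "x \<in> S"
  shows "(f has_real_derivative deriv f x) (at x)"
    and "(deriv f has_real_derivative deriv (deriv f) x) (at x)"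
proof -
  have "((deriv ^^ 0) f) differentiable at x" "((deriv ^^ 1) f) differentiable at x"
    using assms unfolding smooth_on_def by blast+
  then show "(f has_real_derivative deriv f x) (at x)"
    and "(deriv f has_real_derivative deriv (deriv f) x) (at x)"
    by (simp_all add: DERIV_deriv_iff_real_differentiable)
qed

lemma smooth_curve_has_derivative:
  assumes "smooth_curve T Q q" and "t \<in> T"
  shows "((\<lambda>s. q s $ i) has_real_derivative velocity q t $ i) (at t)"
    and "((\<lambda>s. velocity q s $ i) has_real_derivative acceleration q t $ i) (at t)"
proof -
  have s: "smooth_on T (\<lambda>s. q s $ i)"
    using assms unfolding smooth_curve_def by blast
  show "((\<lambda>s. q s $ i) has_real_derivative velocity q t $ i) (at t)"
    using smooth_on_has_derivative(1)[OF s assms(2)] by (simp add: velocity_def)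
  show "((\<lambda>s. velocity q s $ i) has_real_derivative acceleration q t $ i) (at t)"
    using smooth_on_has_derivative(2)[OF s assms(2)] by (simp add: velocity_def acceleration_def)
qed

lemma smooth_on_along_curve:
  assumes "smooth_curve T Q q" and "t \<in> T" and "smooth_on ((\<lambda>q. q $ None) ` Q) f"
  shows "((\<lambda>s. f (q s $ None)) has_real_derivative
            deriv f (q t $ None) * velocity q t $ None) (at t)"
proof -
  have "q t $ None \<in> (\<lambda>q. q $ None) ` Q"
    using assms(1,2) unfolding smooth_curve_def by blast
  from DERIV_chain2[OF smooth_on_has_derivative(1)[OF assms(3) this]
      smooth_curve_has_derivative(1)[OF assms(1,2)]]
  show ?thesis .
qed

lemma partial_velocity_unactuated:
  fixes g :: "real ^ 'm::finite ^ 'm"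
  shows "partial None (Lagrangian g11 g1 g V q) v
    = g11 (q $ None) * v $ None + (\<Sum>a\<in>UNIV. g1 (q $ None) $ a * v $ Some a)"
  unfolding partial_def Lagrangian_def
  by (rule DERIV_imp_deriv) (auto intro!: derivative_eq_intros)

text \<open>The symmetry of \<open>g\<close> merges the two terms that the product rule gives for
  the quadratic form.\<close>

lemma partial_velocity_actuated:
  fixes g :: "real ^ 'm::finite ^ 'm"
  assumes "transpose g = g"
  shows "partial (Some a) (Lagrangian g11 g1 g V q) v
    = g1 (q $ None) $ a * v $ None + (\<Sum>b\<in>UNIV. g $ a $ b * v $ Some b)"
proof -
  have sym: "g $ b $ a = g $ a $ b" for b
    using arg_cong[OF assms, of "\<lambda>M. M $ a $ b"] by (simp add: transpose_def)
  have sec: "((\<lambda>s. if b = a then s else v $ Some b) has_real_derivative (if b = a then 1 else 0)) (at s)"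
    for b s by auto
  have "(\<Sum>b\<in>UNIV. \<Sum>c\<in>UNIV. g $ b $ c * ((if b = a then 1 else 0) * v $ Some c
      + v $ Some b * (if c = a then 1 else 0))) = 2 * (\<Sum>b\<in>UNIV. g $ a $ b * v $ Some b)"
  proof -
    have "(\<Sum>b\<in>UNIV. \<Sum>c\<in>UNIV. g $ b $ c * ((if b = a then 1 else 0) * v $ Some c))
        = (\<Sum>b\<in>UNIV. if b = a then \<Sum>c\<in>UNIV. g $ b $ c * v $ Some c else 0)"
      by (rule sum.cong) auto
    moreover have "(\<Sum>b\<in>UNIV. \<Sum>c\<in>UNIV. g $ b $ c * (v $ Some b * (if c = a then 1 else 0)))
        = (\<Sum>b\<in>UNIV. g $ a $ b * v $ Some b)"
      by (simp add: if_distrib sym cong: if_cong)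
    ultimately show ?thesis
      by (simp add: distrib_left sum.distrib)
  qed
  moreover have "(\<Sum>b\<in>UNIV. g1 (q $ None) $ b * v $ None * (if b = a then 1 else 0))
      = g1 (q $ None) $ a * v $ None"
    by (simp add: if_distrib cong: if_cong)
  \<comment> \<open>The section of a coordinate at the base point, in the form the derivative rules leave it.\<close>
  moreover have "(if b = a then v $ Some a else v $ Some b) = v $ Some b" for b
    by simp
  ultimately show ?thesis
    unfolding partial_def Lagrangian_def
    by (intro DERIV_imp_deriv)
       (auto intro!: derivative_eq_intros sec simp: algebra_simps)
qed

lemma partial_position_unactuated:
  fixes g :: "real ^ 'm::finite ^ 'm"
  assumes "(g11 has_real_derivative deriv g11 (p $ None)) (at (p $ None))"
    and "(V has_real_derivative deriv V (p $ None)) (at (p $ None))"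
    and "\<And>a. ((\<lambda>x. g1 x $ a) has_real_derivative deriv (\<lambda>x. g1 x $ a) (p $ None)) (at (p $ None))"
  shows "partial None (\<lambda>p. Lagrangian g11 g1 g V p v) p
    = 1/2 * deriv g11 (p $ None) * (v $ None)\<^sup>2
      + (\<Sum>a\<in>UNIV. deriv (\<lambda>x. g1 x $ a) (p $ None) * v $ None * v $ Some a)
      - deriv V (p $ None)"
  unfolding partial_def Lagrangian_def
  by (rule DERIV_imp_deriv) (auto intro!: derivative_eq_intros assms)

lemma control_along_eq_control_law:
  fixes g :: "real ^ 'm::finite ^ 'm"
  assumes "smooth_curve T Q q" and "t \<in> T"
    and "\<And>a. smooth_on ((\<lambda>q. q $ None) ` Q) (\<lambda>x. \<tau> x $ a)"
  shows "control_along g \<tau> q a t =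
    control_law g \<tau> a (q t $ None) (velocity q t $ None) (acceleration q t $ None)"
proof -
  note d = smooth_on_along_curve[OF assms(1,2) assms(3)] smooth_curve_has_derivative[OF assms(1,2)]
  have "((\<lambda>s. (\<Sum>b\<in>UNIV. g $ a $ b * \<tau> (q s $ None) $ b) * velocity q s $ None) has_real_derivative
      - control_law g \<tau> a (q t $ None) (velocity q t $ None) (acceleration q t $ None)) (at t)"
    unfolding control_law_def
    by (rule derivative_eq_intros d refl)+
       (simp add: sum_distrib_left sum_distrib_right power2_eq_square algebra_simps)
  from DERIV_imp_deriv[OF this] show ?thesis
    by (simp add: control_along_def)
qed

section \<open>The equations of motion\<close>

text \<open>The part of the equations without accelerations, including that of the control, moved to the
  right-hand side. It has only \<open>xd\<close>, the velocity of \<open>x\<close>, as a velocity argument.\<close>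

definition forcing ::
    "(real \<Rightarrow> real) \<Rightarrow> (real \<Rightarrow> real ^ 'm::finite) \<Rightarrow> real ^ 'm ^ 'm \<Rightarrow> (real \<Rightarrow> real) \<Rightarrow> (real \<Rightarrow> real ^ 'm)
     \<Rightarrow> real \<Rightarrow> real \<Rightarrow> real ^ 'm option" where
  "forcing g11 g1 g V \<tau> x xd = (\<chi> i. case i of
      None \<Rightarrow> - (1/2 * deriv g11 x * xd\<^sup>2 + deriv V x)
    | Some a \<Rightarrow> - (deriv (\<lambda>y. g1 y $ a) x + (\<Sum>b\<in>UNIV. g $ a $ b * deriv (\<lambda>y. \<tau> y $ b) x)) * xd\<^sup>2)"

text \<open>In the \<open>x\<close>-equation the terms \<open>g\<^sub>1\<^sub>a' v\<^sup>1 v\<^sup>a\<close> from the time derivative of the momentum and from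
  the position derivative of \<open>L\<close> cancel. Moving the acceleration part of the control to the
  left-hand side of the \<open>\<theta>\<^sup>a\<close>-equations changes the metric matrix into \<open>C_tilde\<close>.\<close>

lemma controlled_Euler_Lagrange_iff:
  fixes g :: "real ^ 'm::finite ^ 'm"
  defines "I \<equiv> \<lambda>Q. (\<lambda>q. q $ None) ` Q"
  assumes q: "smooth_curve T Q q" "t \<in> T"
    and sm: "smooth_on (I Q) g11" "smooth_on (I Q) V"
      "\<And>a. smooth_on (I Q) (\<lambda>x. g1 x $ a)" "\<And>a. smooth_on (I Q) (\<lambda>x. \<tau> x $ a)"
    and sym: "transpose g = g"
  shows "controlled_Euler_Lagrange (Lagrangian g11 g1 g V) (control_along g \<tau> q) q t \<longleftrightarrow>
    C_tilde g11 g1 g \<tau> (q t $ None) *v acceleration q t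
      = forcing g11 g1 g V \<tau> (q t $ None) (velocity q t $ None)"
proof -
  note sm = sm[unfolded I_def]
  note dq = smooth_curve_has_derivative[OF q]
  note dx = smooth_on_along_curve[OF q sm(1)] smooth_on_along_curve[OF q sm(3)]
  have tI: "q t $ None \<in> (\<lambda>q. q $ None) ` Q"
    using q unfolding smooth_curve_def by blast
  note ds = smooth_on_has_derivative(1)[OF _ tI]
  let ?x = "q t $ None" and ?v = "velocity q t" and ?w = "acceleration q t"
  have 1: "deriv (\<lambda>s. partial None (Lagrangian g11 g1 g V (q s)) (velocity q s)) t
      = deriv g11 ?x * (?v $ None)\<^sup>2 + g11 ?x * ?w $ None
        + (\<Sum>a\<in>UNIV. deriv (\<lambda>y. g1 y $ a) ?x * ?v $ None * ?v $ Some a)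
        + (\<Sum>a\<in>UNIV. g1 ?x $ a * ?w $ Some a)"
    unfolding partial_velocity_unactuated
    by (rule DERIV_imp_deriv, (rule derivative_eq_intros dx dq refl)+)
       (simp add: sum.distrib power2_eq_square algebra_simps)
  have 2: "deriv (\<lambda>s. partial (Some a) (Lagrangian g11 g1 g V (q s)) (velocity q s)) t
      = deriv (\<lambda>y. g1 y $ a) ?x * (?v $ None)\<^sup>2 + g1 ?x $ a * ?w $ None
        + (\<Sum>b\<in>UNIV. g $ a $ b * ?w $ Some b)" for a
    unfolding partial_velocity_actuated[OF sym]
    by (rule DERIV_imp_deriv, (rule derivative_eq_intros dx dq refl)+)
       (simp add: power2_eq_square algebra_simps)
  have 3: "partial None (\<lambda>p. Lagrangian g11 g1 g V p ?v) (q t)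
      = 1/2 * deriv g11 ?x * (?v $ None)\<^sup>2
      + (\<Sum>a\<in>UNIV. deriv (\<lambda>x. g1 x $ a) ?x * ?v $ None * ?v $ Some a) - deriv V ?x"
    by (rule partial_position_unactuated) (rule ds sm)+
  have x_eq: "deriv (\<lambda>s. partial None (Lagrangian g11 g1 g V (q s)) (velocity q s)) t
       - partial None (\<lambda>p. Lagrangian g11 g1 g V p ?v) (q t) = 0 \<longleftrightarrow>
      (C_tilde g11 g1 g \<tau> ?x *v ?w) $ None = forcing g11 g1 g V \<tau> ?x (?v $ None) $ None"
    unfolding 1 3 C_tilde_def block_matrix_mult forcing_def by (simp, argo)
  have \<theta>_eq: "deriv (\<lambda>s. partial (Some a) (Lagrangian g11 g1 g V (q s)) (velocity q s)) t
        = control_along g \<tau> q a t \<longleftrightarrow>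
      (C_tilde g11 g1 g \<tau> ?x *v ?w) $ Some a = forcing g11 g1 g V \<tau> ?x (?v $ None) $ Some a" for a
    unfolding 2 control_along_eq_control_law[OF q sm(4)] C_tilde_def block_matrix_mult
      forcing_def control_law_def
    by (simp add: algebra_simps) argo
  show ?thesis
    unfolding controlled_Euler_Lagrange_def x_eq \<theta>_eq
    by (simp add: vec_eq_iff split_option_all)
qed

text \<open>The \<open>\<theta>\<^sup>a\<close>-equations, multiplied by \<open>g\<^sup>-\<^sup>1\<close>, express the accelerations of the \<open>\<theta>\<^sup>a\<close> by that of
  \<open>x\<close>; here they are inserted in the \<open>x\<close>-equation.\<close>

lemma unactuated_acceleration:
  fixes g :: "real ^ 'm::finite ^ 'm"
  defines "ginv \<equiv> matrix_inv g"
  assumes "invertible g"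
    and eq: "C_tilde g11 g1 g \<tau> x *v w = forcing g11 g1 g V \<tau> x xd"
  shows "(g11 x - g1 x \<bullet> (ginv *v g1 x) - g1 x \<bullet> \<tau> x) * w $ None
    = (g1 x \<bullet> (ginv *v (\<chi> c. deriv (\<lambda>y. g1 y $ c) x)) + g1 x \<bullet> (\<chi> e. deriv (\<lambda>y. \<tau> y $ e) x)
        - 1/2 * deriv g11 x) * xd\<^sup>2 - deriv V x"
proof -
  define g1' where "g1' = (\<chi> c. deriv (\<lambda>y. g1 y $ c) x)"
  define \<tau>' where "\<tau>' = (\<chi> e. deriv (\<lambda>y. \<tau> y $ e) x)"
  define \<theta> where "\<theta> = (\<chi> a. w $ Some a)"
  have x_eq: "g11 x * w $ None + g1 x \<bullet> \<theta> = - (1/2 * deriv g11 x * xd\<^sup>2 + deriv V x)"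
    using arg_cong[OF eq, of "\<lambda>v. v $ None"]
    by (simp add: C_tilde_def block_matrix_mult forcing_def inner_vec_def \<theta>_def)
  have \<theta>_eq: "w $ None *\<^sub>R (g1 x + g *v \<tau> x) + g *v \<theta> + xd\<^sup>2 *\<^sub>R (g1' + g *v \<tau>') = 0"
  proof (rule vec_eq_iff[THEN iffD2], rule allI)
    fix a
    show "(w $ None *\<^sub>R (g1 x + g *v \<tau> x) + g *v \<theta> + xd\<^sup>2 *\<^sub>R (g1' + g *v \<tau>')) $ a
        = 0 $ a"
      using arg_cong[OF eq, of "\<lambda>v. v $ Some a"]
      unfolding C_tilde_def block_matrix_mult
      by (simp add: forcing_def g1'_def \<tau>'_def \<theta>_def matrix_vector_mult_def algebra_simps)
  qed
  have inv: "ginv *v (g *v u) = u" for u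
    using assms(2) by (simp add: ginv_def matrix_vector_mul_assoc matrix_inv_left)
  have "w $ None *\<^sub>R (ginv *v g1 x + \<tau> x) + \<theta> + xd\<^sup>2 *\<^sub>R (ginv *v g1' + \<tau>') = 0"
    using arg_cong[OF \<theta>_eq, of "\<lambda>u. ginv *v u"]
    by (simp add: matrix_vector_right_distrib matrix_vector_mult_scaleR inv
        scaleR_add_right)
  from arg_cong[OF this, of "\<lambda>u. g1 x \<bullet> u"]
  have "w $ None * (g1 x \<bullet> (ginv *v g1 x) + g1 x \<bullet> \<tau> x) + g1 x \<bullet> \<theta>
      + xd\<^sup>2 * (g1 x \<bullet> (ginv *v g1') + g1 x \<bullet> \<tau>') = 0"
    by (simp add: inner_add_right)
  with x_eq show ?thesis
    unfolding g1'_def[symmetric] \<tau>'_def[symmetric] by (simp add: algebra_simps)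
qed

text \<open>Multiplying the control by \<open>A\<close> and inserting the scalar equation for \<open>xdd\<close> makes the
  coefficient of \<open>xd\<^sup>2\<close> equal to \<open>- (g\<^sub>a\<^sub>b (\<tau>\<^sup>b B + A (\<tau>\<^sup>b)'))\<close>, which is zero. In the application the last
  hypothesis is the ODE system for \<open>\<tau>\<close>, divided by two.\<close>

lemma control_law_velocity_independent:
  fixes g :: "real ^ 'm::finite ^ 'm"
  assumes "A \<noteq> 0" and acc: "A * xdd = B * xd\<^sup>2 - W"
    and ode: "\<And>b. \<tau> x $ b * B + A * deriv (\<lambda>y. \<tau> y $ b) x = 0"
  shows "control_law g \<tau> a x xd xdd = (\<Sum>b\<in>UNIV. g $ a $ b * \<tau> x $ b) * W / A"
proof -
  have b: "deriv (\<lambda>y. \<tau> y $ b) x * xd\<^sup>2 + \<tau> x $ b * xdd = - (\<tau> x $ b * W / A)" for b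
  proof -
    have "A * (deriv (\<lambda>y. \<tau> y $ b) x * xd\<^sup>2 + \<tau> x $ b * xdd)
        = (\<tau> x $ b * B + A * deriv (\<lambda>y. \<tau> y $ b) x) * xd\<^sup>2 + \<tau> x $ b * (A * xdd - B * xd\<^sup>2)"
      by (simp add: algebra_simps)
    also have "\<dots> = - (\<tau> x $ b * W)"
      by (simp add: ode acc)
    finally show ?thesis
      using \<open>A \<noteq> 0\<close> by (simp add: field_simps)
  qed
  have "control_law g \<tau> a x xd xdd
      = - (\<Sum>b\<in>UNIV. g $ a $ b * (deriv (\<lambda>y. \<tau> y $ b) x * xd\<^sup>2 + \<tau> x $ b * xdd))"
    by (simp add: control_law_def sum.distrib sum_distrib_right distrib_left mult.assoc)
  also have "\<dots> = (\<Sum>b\<in>UNIV. g $ a $ b * \<tau> x $ b) * W / A"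
    unfolding b by (simp add: sum_negf sum_distrib_right sum_divide_distrib mult.assoc)
  finally show ?thesis .
qed

theorem proposition3p2:
  fixes Q :: "(real ^ 'm::finite option) set"
    and I :: "real set"
    and g11 V :: "real \<Rightarrow> real"
    and g1 \<tau> :: "real \<Rightarrow> real ^ 'm"
    and g ginv :: "real ^ 'm ^ 'm"
    and \<sigma> :: real
  defines "I \<equiv> (\<lambda>q. q $ None) ` Q"
    and "ginv \<equiv> matrix_inv g"
  assumes "open Q"
    and "smooth_on I g11"
    and "smooth_on I V"
    and "\<And>a. smooth_on I (\<lambda>x. g1 x $ a)"
    and "\<And>a. smooth_on I (\<lambda>x. \<tau> x $ a)"
    and "transpose g = g"
    and "\<And>x. x \<in> I \<Longrightarrow> positive_definite_matrix (metric_matrix g11 g1 g x)"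
    and "\<And>x. x \<in> I \<Longrightarrow> invertible (C_tilde g11 g1 g \<tau> x)"
    and "\<And>x v. x \<in> I \<Longrightarrow> invertible (hessian (controlled_kinetic g11 g1 g \<tau> \<sigma> x) v)"
    and "\<And>x a. x \<in> I \<Longrightarrow>
        2 * \<tau> x $ a * (\<Sum>e\<in>UNIV. \<Sum>c\<in>UNIV. g1 x $ e * ginv $ e $ c * deriv (\<lambda>y. g1 y $ c) x)
      + 2 * \<tau> x $ a * (\<Sum>e\<in>UNIV. g1 x $ e * deriv (\<lambda>y. \<tau> y $ e) x)
      - \<tau> x $ a * deriv g11 x
      + 2 * g11 x * deriv (\<lambda>y. \<tau> y $ a) x
      - 2 * (\<Sum>c\<in>UNIV. \<Sum>d\<in>UNIV. g1 x $ c * ginv $ d $ c * g1 x $ d) * deriv (\<lambda>y. \<tau> y $ a) x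
      - 2 * (\<Sum>c\<in>UNIV. g1 x $ c * \<tau> x $ c) * deriv (\<lambda>y. \<tau> y $ a) x = 0"
  shows "(\<forall>T q t a. smooth_curve T Q q \<and> t \<in> T \<longrightarrow>
            control_along g \<tau> q a t =
              control_law g \<tau> a (q t $ None) (velocity q t $ None) (acceleration q t $ None))
       \<and> (\<exists>acc :: real ^ 'm option \<Rightarrow> real ^ 'm option \<Rightarrow> real ^ 'm option.
            (\<forall>T q t. smooth_curve T Q q \<and> t \<in> T \<longrightarrow>
               (controlled_Euler_Lagrange (Lagrangian g11 g1 g V) (control_along g \<tau> q) q t
                  \<longleftrightarrow> acceleration q t = acc (q t) (velocity q t)))
          \<and> (\<exists>U :: 'm \<Rightarrow> real ^ 'm option \<Rightarrow> real.
               \<forall>p\<in>Q. \<forall>v a. control_law g \<tau> a (p $ None) (v $ None) (acc p v $ None) = U a p))"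
proof (intro conjI)
  have g_inv: "invertible g" if "x \<in> I" for x
    using invertible_actuated_block[OF assms(9)[OF that]] .
  show "\<forall>T q t a. smooth_curve T Q q \<and> t \<in> T \<longrightarrow>
            control_along g \<tau> q a t =
              control_law g \<tau> a (q t $ None) (velocity q t $ None) (acceleration q t $ None)"
    using control_along_eq_control_law assms(7) unfolding I_def by blast
  \<comment> \<open>Off \<open>Q\<close>, where the matrix may be singular, the value of \<open>acc\<close> is arbitrary.\<close>
  define acc where "acc = (\<lambda>(p :: real ^ 'm option) (v :: real ^ 'm option).
      matrix_inv (C_tilde g11 g1 g \<tau> (p $ None)) *v forcing g11 g1 g V \<tau> (p $ None) (v $ None))"
  have acc_iff: "C_tilde g11 g1 g \<tau> (p $ None) *v w = forcing g11 g1 g V \<tau> (p $ None) (v $ None)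
      \<longleftrightarrow> w = acc p v" if "p \<in> Q" for p v w
  proof -
    have "invertible (C_tilde g11 g1 g \<tau> (p $ None))"
      using assms(10) that by (simp add: I_def)
    from matrix_inv_left[OF this] matrix_inv_right[OF this] show ?thesis
      unfolding acc_def by (metis matrix_vector_mul_assoc matrix_vector_mul_lid)
  qed
  define A where "A = (\<lambda>x. g11 x - g1 x \<bullet> (ginv *v g1 x) - g1 x \<bullet> \<tau> x)"
  define U where "U = (\<lambda>a (p :: real ^ 'm option). (\<Sum>b\<in>UNIV. g $ a $ b * \<tau> (p $ None) $ b)
      * deriv V (p $ None) / A (p $ None))"
  show "\<exists>acc. (\<forall>T q t. smooth_curve T Q q \<and> t \<in> T \<longrightarrow>
               (controlled_Euler_Lagrange (Lagrangian g11 g1 g V) (control_along g \<tau> q) q t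
                  \<longleftrightarrow> acceleration q t = acc (q t) (velocity q t)))
          \<and> (\<exists>U. \<forall>p\<in>Q. \<forall>v a. control_law g \<tau> a (p $ None) (v $ None) (acc p v $ None) = U a p)"
  proof (intro exI[of _ acc] conjI exI[of _ U] allI impI ballI; (elim conjE)?)
    fix T q t
    assume q: "smooth_curve T Q q" "t \<in> T"
    then have "q t \<in> Q"
      unfolding smooth_curve_def by blast
    then show "controlled_Euler_Lagrange (Lagrangian g11 g1 g V) (control_along g \<tau> q) q t
        \<longleftrightarrow> acceleration q t = acc (q t) (velocity q t)"
      using controlled_Euler_Lagrange_iff[OF q] assms(4-8) acc_iff unfolding I_def by blast
  next
    fix p v a
    assume p: "p \<in> Q"
    define x where "x = p $ None"
    have x: "x \<in> I"
      using p by (simp add: x_def I_def)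
    have "matrix_inv g *v (\<chi> a. g1 x $ a + (\<Sum>d\<in>UNIV. g $ a $ d * \<tau> x $ d)) = ginv *v g1 x + \<tau> x"
    proof -
      have "(\<chi> a. g1 x $ a + (\<Sum>d\<in>UNIV. g $ a $ d * \<tau> x $ d)) = g1 x + g *v \<tau> x"
        by (simp add: vec_eq_iff matrix_vector_mult_def)
      then show ?thesis
        using g_inv[OF x]
        by (simp add: ginv_def matrix_vector_right_distrib matrix_vector_mul_assoc matrix_inv_left)
    qed
    then have "A x \<noteq> 0"
      using Schur_complement_nonzero[OF assms(10)[OF x, unfolded C_tilde_def] g_inv[OF x]]
      by (simp add: A_def inner_add_right algebra_simps)
    define B where "B = g1 x \<bullet> (ginv *v (\<chi> c. deriv (\<lambda>y. g1 y $ c) x))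
        + g1 x \<bullet> (\<chi> e. deriv (\<lambda>y. \<tau> y $ e) x) - 1/2 * deriv g11 x"
    have "A x * acc p v $ None = B * (v $ None)\<^sup>2 - deriv V x"
      unfolding A_def B_def ginv_def
      using unactuated_acceleration[OF g_inv[OF x]] acc_iff[OF p] unfolding x_def by blast
    moreover have "\<tau> x $ b * B + A x * deriv (\<lambda>y. \<tau> y $ b) x = 0" for b
    proof -
      have 1: "(\<Sum>e\<in>UNIV. \<Sum>c\<in>UNIV. g1 x $ e * ginv $ e $ c * deriv (\<lambda>y. g1 y $ c) x)
          = g1 x \<bullet> (ginv *v (\<chi> c. deriv (\<lambda>y. g1 y $ c) x))"
        by (simp add: inner_vec_def matrix_vector_mult_def sum_distrib_left mult.assoc)
      have 2: "(\<Sum>c\<in>UNIV. \<Sum>d\<in>UNIV. g1 x $ c * ginv $ d $ c * g1 x $ d) = g1 x \<bullet> (ginv *v g1 x)"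
        by (subst sum.swap) (simp add: inner_vec_def matrix_vector_mult_def sum_distrib_left mult_ac)
      have 3: "(\<Sum>e\<in>UNIV. g1 x $ e * deriv (\<lambda>y. \<tau> y $ e) x) = g1 x \<bullet> (\<chi> e. deriv (\<lambda>y. \<tau> y $ e) x)"
        "(\<Sum>c\<in>UNIV. g1 x $ c * \<tau> x $ c) = g1 x \<bullet> \<tau> x"
        by (simp_all add: inner_vec_def)
      show ?thesis
        using assms(12)[OF x, of b] unfolding 1 2 3 A_def B_def by (simp add: algebra_simps)
    qed
    ultimately have "control_law g \<tau> a x (v $ None) (acc p v $ None)
        = (\<Sum>b\<in>UNIV. g $ a $ b * \<tau> x $ b) * deriv V x / A x"
      by (rule control_law_velocity_independent[OF \<open>A x \<noteq> 0\<close>])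
    then show "control_law g \<tau> a (p $ None) (v $ None) (acc p v $ None) = U a p"
      by (simp add: U_def x_def)
  qed
qed

end
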